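(* Let $\mathcal{S}=\{X_1,\ldots,X_k\}$ be a finite set of random variables and $Y$ a random variable not in $\mathcal{S}$. The following two algorithms, which take as input the joint distribution of $\mathcal{S}$ and $Y$ (so that conditional independences and values of $\Delta$ are evaluated exactly), are sound and complete. Algorithm 1. (1) Set $\mathcal{M}_0=\mathcal{S}$. (2) Repeat: let $X_0\in\arg\min_{X\in\mathcal{M}_0}\Delta(X,Y\mid\mathcal{M}_0\setminus\{X\})$ (ties broken arbitrarily); if $X_0\perp Y\mid\mathcal{M}_0\setminus\{X_0\}$, replace $\mathcal{M}_0$ by $\mathcal{M}_0\setminus\{X_0\}$; until $X_0\not\perp Y\mid\mathcal{M}_0\setminus\{X_0\}$ (or $\mathcal{M}_0=\emptyset$). (3) Output $\mathcal{M}_0$. Algorithm 2. Let $\Omega$ be any algorithm which correctly produces one Markov boundary of $Y$ within any given subset of $\mathcal{S}$. (1) Let $\mathcal{M}_0=\{X_1,\ldots,X_m\}$ (after relabelling) be the output of $\Omega$ on $\mathcal{S}$. (2) For $i=1,\ldots,m$: let $\mathcal{M}_i$ be the output of $\Omega$ on $\mathcal{S}\setminus\{X_i\}$; if $Y\perp\mathcal{M}_0\mid\mathcal{M}_i$, output "$Y$ has multiple Markov boundaries" and terminate. (3) Otherwise output "$Y$ has a unique Markov boundary". That is: Algorithm 1 always terminates in finitely many steps and its output $\mathcal{M}_0$ is a Markov boundary of $Y$ within $\mathcal{S}$; and Algorithm 2 always terminates in finitely many steps, and its output correctly states whether $Y$ has a unique Markov boundary or multiple Markov boundaries within $\mathc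al{S}$.
   Context: Sets of random variables are identified with the corresponding random vectors; $\perp$ denotes (conditional) statistical independence, $\not\perp$ its negation, and independence from the empty set holds trivially. For a set $\mathcal{T}$ of variables not containing $Y$, a subset $\mathcal{M}\subseteq\mathcal{T}$ is a Markov blanket of $Y$ within $\mathcal{T}$ if $Y\perp(\mathcal{T}\setminus\mathcal{M})\mid\mathcal{M}$. A Markov boundary is a Markov blanket none of whose proper subsets is a Markov blanket. $\Delta(\cdot,\cdot\mid\cdot)$ is a real-valued measure of (conditional) association between two random variables, with larger values indicating stronger association, in the sense that if two variables with association value $\Delta=d_1$ are (conditionally) dependent, then any other two variables with association value $\Delta=d_2\ge d_1$ are also (conditionally) dependent; an example is conditional mutual information. *)

theory Defs
  imports "HOL-Probability.Probability"
begin

text \<open>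
  Random variables on a probability space \<open>P\<close> are given as a labelled family \<open>X\<close>, where \<open>X i\<close>
  takes values in the measurable space \<open>N i\<close>; a set of random variables is a set of labels.
  The spaces \<open>N i\<close> may differ from each other, although they share the carrier type \<open>'a\<close>.
\<close>

definition rvec :: "('i \<Rightarrow> 'w \<Rightarrow> 'a) \<Rightarrow> 'i set \<Rightarrow> 'w \<Rightarrow> 'i \<Rightarrow> 'a" where
  "rvec X A \<omega> = (\<lambda>i\<in>A. X i \<omega>)"

definition rvec_algebra ::
  "'w measure \<Rightarrow> ('i \<Rightarrow> 'a measure) \<Rightarrow> ('i \<Rightarrow> 'w \<Rightarrow> 'a) \<Rightarrow> 'i set \<Rightarrow> 'w measure" where
  "rvec_algebra P N X A = vimage_algebra (space P) (rvec X A) (PiM A N)"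

text \<open>
  \<open>A\<close> and \<open>B\<close> are independent given \<open>C\<close>. The sets may overlap. For \<open>C = {}\<close> the conditioning
  algebra is trivial and this is unconditional independence; for \<open>A = {}\<close> or \<open>B = {}\<close> it
  always holds.
\<close>

definition cond_indep ::
  "'w measure \<Rightarrow> ('i \<Rightarrow> 'a measure) \<Rightarrow> ('i \<Rightarrow> 'w \<Rightarrow> 'a) \<Rightarrow> 'i set \<Rightarrow> 'i set \<Rightarrow> 'i set \<Rightarrow> bool" where
  "cond_indep P N X A B C \<longleftrightarrow>
     (\<forall>E \<in> sets (rvec_algebra P N X A). \<forall>F \<in> sets (rvec_algebra P N X B).
        AE \<omega> in P.
          real_cond_exp P (rvec_algebra P N X C) (indicator (E \<inter> F)) \<omega> =
          real_cond_exp P (rvec_algebra P N X C) (indicator E) \<omega> *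
          real_cond_exp P (rvec_algebra P N X C) (indicator F) \<omega>)"

definition markov_blanket ::
  "'w measure \<Rightarrow> ('i \<Rightarrow> 'a measure) \<Rightarrow> ('i \<Rightarrow> 'w \<Rightarrow> 'a) \<Rightarrow> 'i \<Rightarrow> 'i set \<Rightarrow> 'i set \<Rightarrow> bool" where
  "markov_blanket P N X y T B \<longleftrightarrow> B \<subseteq> T \<and> cond_indep P N X {y} (T - B) B"

definition markov_boundary ::
  "'w measure \<Rightarrow> ('i \<Rightarrow> 'a measure) \<Rightarrow> ('i \<Rightarrow> 'w \<Rightarrow> 'a) \<Rightarrow> 'i \<Rightarrow> 'i set \<Rightarrow> 'i set \<Rightarrow> bool" where
  "markov_boundary P N X y T B \<longleftrightarrow>
     markov_blanket P N X y T B \<and> (\<forall>B'. B' \<subset> B \<longrightarrow> \<not> markov_blanket P N X y T B')"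

text \<open>
  \<open>\<Delta> u v C\<close> is the association of the distinct variables \<open>u\<close>, \<open>v\<close> of \<open>V\<close> given the set \<open>C\<close> of
  further variables of \<open>V\<close>. Association values are comparable across different conditioning sets.
\<close>

definition association_measure ::
  "'w measure \<Rightarrow> ('i \<Rightarrow> 'a measure) \<Rightarrow> ('i \<Rightarrow> 'w \<Rightarrow> 'a) \<Rightarrow> 'i set \<Rightarrow>
     ('i \<Rightarrow> 'i \<Rightarrow> 'i set \<Rightarrow> real) \<Rightarrow> bool" where
  "association_measure P N X V \<Delta> \<longleftrightarrow>
     (\<forall>u v C u' v' C'.
        u \<in> V \<and> v \<in> V \<and> u \<noteq> v \<and> C \<subseteq> V - {u, v} \<and>
        u' \<in> V \<and> v' \<in> V \<and> u' \<noteq> v' \<and> C' \<subseteq> V - {u', v'} \<and>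
        \<not> cond_indep P N X {u} {v} C \<and> \<Delta> u v C \<le> \<Delta> u' v' C' \<longrightarrow>
        \<not> cond_indep P N X {u'} {v'} C')"

text \<open>
  Algorithms are nondeterministic transition relations. All runs from \<open>init\<close> are required to be
  finite, and none may get stuck outside \<open>final\<close>.
\<close>

definition always_terminates :: "('s \<Rightarrow> 's \<Rightarrow> bool) \<Rightarrow> 's \<Rightarrow> 's set \<Rightarrow> bool" where
  "always_terminates step init final \<longleftrightarrow>
     \<not> (\<exists>r. r 0 = init \<and> (\<forall>n::nat. step (r n) (r (Suc n)))) \<and>
     (\<forall>s. step\<^sup>*\<^sup>* init s \<and> \<not> (\<exists>s'. step s s') \<longrightarrow> s \<in> final)"

datatype 'i alg1_state = Loop1 "'i set" | Output1 "'i set"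

inductive alg1_step ::
  "'w measure \<Rightarrow> ('i \<Rightarrow> 'a measure) \<Rightarrow> ('i \<Rightarrow> 'w \<Rightarrow> 'a) \<Rightarrow> ('i \<Rightarrow> 'i \<Rightarrow> 'i set \<Rightarrow> real) \<Rightarrow> 'i \<Rightarrow>
     'i alg1_state \<Rightarrow> 'i alg1_state \<Rightarrow> bool"
  for P N X \<Delta> y
where
  alg1_empty: "alg1_step P N X \<Delta> y (Loop1 {}) (Output1 {})"
| alg1_remove:
    "is_arg_min (\<lambda>x. \<Delta> x y (B - {x})) (\<lambda>x. x \<in> B) x0 \<Longrightarrow>
     cond_indep P N X {x0} {y} (B - {x0}) \<Longrightarrow>
     alg1_step P N X \<Delta> y (Loop1 B) (Loop1 (B - {x0}))"
| alg1_stop: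
    "is_arg_min (\<lambda>x. \<Delta> x y (B - {x})) (\<lambda>x. x \<in> B) x0 \<Longrightarrow>
     \<not> cond_indep P N X {x0} {y} (B - {x0}) \<Longrightarrow>
     alg1_step P N X \<Delta> y (Loop1 B) (Output1 B)"

text \<open>
  \<open>\<Omega> T B\<close> means that \<open>B\<close> is a possible output of the subroutine \<open>\<Omega>\<close> on the input \<open>T\<close>; a
  deterministic subroutine is the special case of a functional relation.
\<close>

definition correct_boundary_algorithm ::
  "'w measure \<Rightarrow> ('i \<Rightarrow> 'a measure) \<Rightarrow> ('i \<Rightarrow> 'w \<Rightarrow> 'a) \<Rightarrow> 'i \<Rightarrow> 'i set \<Rightarrow>
     ('i set \<Rightarrow> 'i set \<Rightarrow> bool) \<Rightarrow> bool" where
  "correct_boundary_algorithm P N X y S \<Omega> \<longleftrightarrow>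
     (\<forall>T. T \<subseteq> S \<longrightarrow> (\<exists>B. \<Omega> T B) \<and> (\<forall>B. \<Omega> T B \<longrightarrow> markov_boundary P N X y T B))"

datatype verdict = Unique_Boundary | Multiple_Boundaries

text \<open>
  In \<open>Loop2 B xs\<close>, \<open>B\<close> is the boundary found first and \<open>xs\<close> lists those of its elements that are
  still to be examined; the enumeration of \<open>B\<close> is arbitrary.
\<close>

datatype 'i alg2_state = Start2 | Loop2 "'i set" "'i list" | Output2 verdict

inductive alg2_step ::
  "'w measure \<Rightarrow> ('i \<Rightarrow> 'a measure) \<Rightarrow> ('i \<Rightarrow> 'w \<Rightarrow> 'a) \<Rightarrow> ('i set \<Rightarrow> 'i set \<Rightarrow> bool) \<Rightarrow> 'i \<Rightarrow>
     'i set \<Rightarrow> 'i alg2_state \<Rightarrow> 'i alg2_state \<Rightarrow> bool"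
  for P N X \<Omega> y S
where
  alg2_start:
    "\<Omega> S B \<Longrightarrow> set xs = B \<Longrightarrow> distinct xs \<Longrightarrow> alg2_step P N X \<Omega> y S Start2 (Loop2 B xs)"
| alg2_multiple:
    "\<Omega> (S - {x}) B' \<Longrightarrow> cond_indep P N X {y} B B' \<Longrightarrow>
     alg2_step P N X \<Omega> y S (Loop2 B (x # xs)) (Output2 Multiple_Boundaries)"
| alg2_next:
    "\<Omega> (S - {x}) B' \<Longrightarrow> \<not> cond_indep P N X {y} B B' \<Longrightarrow>
     alg2_step P N X \<Omega> y S (Loop2 B (x # xs)) (Loop2 B xs)"
| alg2_unique:
    "alg2_step P N X \<Omega> y S (Loop2 B []) (Output2 Unique_Boundary)"

end

theory Submission
  imports Defs
begin

text \<open>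
  By Doob's characterization, \<open>A\<close> and \<open>B\<close> are independent given \<open>C\<close> iff every event of \<open>A\<close> has the
  same conditional probability given \<open>B \<union> C\<close> as given \<open>C\<close>. Fix \<open>A = {y}\<close> and call two sets of
  variables equivalent if they give the same conditional probabilities of the events of \<open>y\<close>.
  Then \<open>B\<close> is a Markov blanket within \<open>S\<close> iff \<open>B \<subseteq> S\<close> is equivalent to \<open>S\<close>, and by the tower property
  equivalent sets \<open>C \<subseteq> T\<close> are equivalent to every set between them. Both algorithms reduce to
  manipulations of this equivalence. For Algorithm 1, a blanket properly contained in \<open>B\<close> omits
  some \<open>x \<in> B\<close>, and then \<open>B - {x}\<close> is equivalent to \<open>B\<close>. For Algorithm 2, a boundary \<open>C \<noteq> B\<close> omits some
  \<open>x \<in> B\<close>, and then every boundary within \<open>S - {x}\<close> is equivalent to \<open>C\<close>, hence a blanket within \<open>S\<close>.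
\<close>

section \<open>Doob's characterization of conditional independence\<close>

text \<open>Dynkin's argument: equality of the integrals passes to disjoint unions by countable
  additivity, and to complements by subtraction from the integral over the whole space.
  \<open>space M \<in> G\<close> supplies the equality of these total integrals.\<close>

lemma set_integral_eq_on_sigma_sets:
  fixes f g :: "'a \<Rightarrow> real"
  assumes f: "integrable M f" and g: "integrable M g"
    and G: "Int_stable G" "G \<subseteq> sets M" "space M \<in> G"
    and eq: "\<And>A. A \<in> G \<Longrightarrow> (LINT x:A|M. f x) = (LINT x:A|M. g x)"
    and A: "A \<in> sigma_sets (space M) G"
  shows "(LINT x:A|M. f x) = (LINT x:A|M. g x)"
proof -
  have sub: "sigma_sets (space M) G \<subseteq> sets M"
    using G(2) by (rule sets.sigma_sets_subset)
  have int: "set_integrable M B h" if "integrable M h" "B \<in> sets M" for B and h :: "'a \<Rightarrow> real"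
    using that unfolding set_integrable_def by (intro integrable_mult_indicator)
  have diff: "(LINT x:space M - B|M. h x) = (LINT x|M. h x) - (LINT x:B|M. h x)"
    if h: "integrable M h" and B: "B \<in> sets M" for B and h :: "'a \<Rightarrow> real"
  proof -
    have "(LINT x:(space M - B) \<union> B|M. h x) = (LINT x:space M - B|M. h x) + (LINT x:B|M. h x)"
      using h B by (intro set_integral_Un int) auto
    moreover have "(space M - B) \<union> B = space M"
      using sets.sets_into_space[OF B] by blast
    ultimately show ?thesis
      using set_integral_space[OF h] by simp
  qed
  have GPow: "G \<subseteq> Pow (space M)"
    using G(2) sets.space_closed by blast
  show ?thesis
    using G(1) GPow A
  proof (induction rule: sigma_sets_induct_disjoint)
    case (basic A)
    then show ?case by (rule eq)
  next
    case empty
    then show ?case by (simp add: set_lebesgue_integral_def)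
  next
    case (compl A)
    then show ?case
      using sub eq[OF G(3)] by (auto simp: diff f g set_integral_space)
  next
    case (union A)
    then have m: "\<And>i. A i \<in> sets M" using sub by auto
    have d: "i \<noteq> j \<Longrightarrow> A i \<inter> A j = {}" for i j
      using union(1) by (auto simp: disjoint_family_on_def)
    have "(LINT x:(\<Union>i. A i)|M. f x) = (\<Sum>i. (LINT x:(A i)|M. f x))"
      using m d f by (intro lebesgue_integral_countable_add int) auto
    also have "\<dots> = (\<Sum>i. (LINT x:(A i)|M. g x))"
      using union(3) by simp
    also have "\<dots> = (LINT x:(\<Union>i. A i)|M. g x)"
      using m d g by (intro lebesgue_integral_countable_add[symmetric] int) auto
    finally show ?case .
  qed
qed

lemma (in prob_space) sigma_finite_subalgebraI:
  "subalgebra M F \<Longrightarrow> sigma_finite_subalgebra M F"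
  by (intro finite_measure_subalgebra_is_sigma_finite finite_measure_subalgebra.intro
      finite_measure_subalgebra_axioms.intro finite_measure_axioms)

text \<open>The inclusions and \<open>gen\<close> make \<open>D\<close> the join of \<open>B\<close>
  and \<open>C\<close>. For the direction from right to left, condition \<open>E \<inter> F\<close>
  first on \<open>D\<close>, which pulls out \<open>F\<close>, and then on \<open>C\<close>.
  Conversely, the conditional probability given \<open>C\<close> is shown to have the integrals that
  characterize the one given \<open>D\<close>.\<close>

lemma (in prob_space) cond_exp_factorizes_iff_cond_exp_eq:
  assumes C: "subalgebra M C" and D: "subalgebra M D" and CD: "subalgebra D C"
    and B: "subalgebra M B" and BD: "sets B \<subseteq> sets D"
    and gen: "sets D \<subseteq> sigma_sets (space M) {F \<inter> G | F G. F \<in> sets B \<and> G \<in> sets C}"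
    and E [measurable]: "E \<in> sets M"
  shows "(\<forall>F\<in>sets B. AE x in M. real_cond_exp M C (indicator (E \<inter> F)) x =
            real_cond_exp M C (indicator E) x * real_cond_exp M C (indicator F) x) \<longleftrightarrow>
         (AE x in M. real_cond_exp M D (indicator E) x = real_cond_exp M C (indicator E) x)"
    (is "?fact \<longleftrightarrow> ?eq")
proof -
  interpret C: sigma_finite_subalgebra M C using C by (rule sigma_finite_subalgebraI)
  interpret D: sigma_finite_subalgebra M D using D by (rule sigma_finite_subalgebraI)
  have int_ind: "integrable M (indicator A :: 'a \<Rightarrow> real)" if "A \<in> sets M" for A
    using that by (simp add: emeasure_eq_measure)
  have BM: "F \<in> sets M" if "F \<in> sets B" for F using B that by (auto simp: subalgebra_def)
  have CM: "F \<in> sets M" if "F \<in> sets C" for F using C that by (auto simp: subalgebra_def)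
  let ?e = "real_cond_exp M C (indicator E)"
  have inte: "integrable M ?e" by (intro C.real_cond_exp_int int_ind E)
  have inte_mult: "integrable M (\<lambda>x. ?e x * indicator F x)" if "F \<in> sets M" for F
    using integrable_mult_indicator[OF that inte] by (simp add: mult.commute)
  show ?thesis
  proof
    assume eq: ?eq
    show ?fact
    proof
      fix F assume F: "F \<in> sets B"
      have FM [measurable]: "F \<in> sets M" using BM F .
      have FD [measurable]: "F \<in> sets D" using BD F by auto
      have "AE x in M. real_cond_exp M D (\<lambda>x. indicator F x * indicator E x) x
              = indicator F x * real_cond_exp M D (indicator E) x"
        by (intro D.real_cond_exp_mult)
          (auto simp: indicator_inter_arith[symmetric] Int_commute intro!: int_ind)
      then have 1: "AE x in M. real_cond_exp M D (indicator (E \<inter> F)) x = ?e x * indicator F x"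
        using eq by eventually_elim (simp add: indicator_inter_arith[abs_def] mult.commute)
      have "AE x in M. real_cond_exp M C (real_cond_exp M D (indicator (E \<inter> F))) x
              = real_cond_exp M C (\<lambda>x. ?e x * indicator F x) x"
        by (rule C.real_cond_exp_cong[OF 1]) measurable
      moreover have "AE x in M. real_cond_exp M C (real_cond_exp M D (indicator (E \<inter> F))) x
              = real_cond_exp M C (indicator (E \<inter> F)) x"
        by (intro C.real_cond_exp_nested_subalg D CD int_ind) measurable
      moreover have "AE x in M. real_cond_exp M C (\<lambda>x. ?e x * indicator F x) x
              = ?e x * real_cond_exp M C (indicator F) x"
        by (intro C.real_cond_exp_mult inte_mult FM) measurable
      ultimately show "AE x in M. real_cond_exp M C (indicator (E \<inter> F)) x
          = ?e x * real_cond_exp M C (indicator F) x"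
        by eventually_elim simp
    qed
  next
    assume fact: ?fact
    let ?G = "{F \<inter> G | F G. F \<in> sets B \<and> G \<in> sets C}"
    have rect: "(LINT x:F \<inter> G|M. indicator E x) = (LINT x:F \<inter> G|M. ?e x)"
      if F: "F \<in> sets B" and G [measurable]: "G \<in> sets C" for F G
    proof -
      have [measurable]: "F \<in> sets M" "G \<in> sets M" using BM CM F G by auto
      \<comment> \<open>The factor \<open>indicator G x * ?e x\<close> is
        \<open>C\<close>-measurable, so \<open>F\<close> may be replaced by its conditional
        probability given \<open>C\<close>; factorization merges that with \<open>?e\<close>, and
        the conditioning is then undone.\<close>
      have "(LINT x:F \<inter> G|M. ?e x) = (LINT x|M. (indicator G x * ?e x) * indicator F x)"
        by (simp add: set_lebesgue_integral_def indicator_inter_arith ac_simps)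
      also have "\<dots> = (LINT x|M. (indicator G x * ?e x) * real_cond_exp M C (indicator F) x)"
        using integrable_mult_indicator[of "F \<inter> G", OF _ inte]
        by (intro C.real_cond_exp_intg(2)[symmetric])
          (auto simp: indicator_inter_arith ac_simps)
      also have "\<dots> = (LINT x|M. indicator G x * real_cond_exp M C (indicator (E \<inter> F)) x)"
        using fact F by (intro integral_cong_AE) (auto elim!: eventually_mono simp: mult.assoc)
      also have "\<dots> = (LINT x|M. indicator G x * indicator (E \<inter> F) x)"
        by (intro C.real_cond_exp_intg(2))
          (auto simp: indicator_inter_arith[symmetric] intro!: int_ind)
      also have "\<dots> = (LINT x:F \<inter> G|M. indicator E x)"
        by (simp add: set_lebesgue_integral_def indicator_inter_arith ac_simps)
      finally show ?thesis by simp
    qed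
    \<comment> \<open>By a \<open>\<pi>\<close>-\<open>\<lambda>\<close> argument it suffices to compare the integrals over the sets \<open>F \<inter> G\<close>.\<close>
    have stable: "Int_stable ?G"
    proof (rule Int_stableI)
      fix a b assume "a \<in> ?G" "b \<in> ?G"
      then obtain F G F' G' where "a = F \<inter> G" "b = F' \<inter> G'" "F \<in> sets B" "F' \<in> sets B"
        "G \<in> sets C" "G' \<in> sets C" by blast
      then have "a \<inter> b = (F \<inter> F') \<inter> (G \<inter> G')" "F \<inter> F' \<in> sets B" "G \<inter> G' \<in> sets C" by auto
      then show "a \<inter> b \<in> ?G" by blast
    qed
    have sub: "?G \<subseteq> sets M" using BM CM by auto
    have top: "space M \<in> ?G"
    proof -
      have "space M \<in> sets B" "space M \<in> sets C"
        using B C sets.top[of B] sets.top[of C] by (auto simp: subalgebra_def)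
      then have "space M \<inter> space M \<in> ?G" by blast
      then show ?thesis by simp
    qed
    have "(LINT x:A|M. indicator E x) = (LINT x:A|M. ?e x)" if "A \<in> sets D" for A
    proof (rule set_integral_eq_on_sigma_sets[OF int_ind[OF E] inte stable sub top])
      show "(LINT x:A|M. indicator E x) = (LINT x:A|M. ?e x)" if "A \<in> ?G" for A
        using that rect by auto
      show "A \<in> sigma_sets (space M) ?G"
        using that gen by auto
    qed
    \<comment> \<open>\<open>?e\<close> is \<open>C\<close>-measurable, hence
      \<open>D\<close>-measurable, and now has the integrals of \<open>indicator E\<close> over all
      sets of \<open>D\<close>. These two properties determine the conditional expectation almost
      everywhere.\<close>
    then show ?eq
      using measurable_from_subalg[OF CD borel_measurable_cond_exp]
      by (intro D.real_cond_exp_charact int_ind inte E) auto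
  qed
qed

section \<open>Sigma-algebras generated by sets of variables\<close>

locale random_family = prob_space P for P :: "'w measure" +
  fixes N :: "'i \<Rightarrow> 'a measure" and X :: "'i \<Rightarrow> 'w \<Rightarrow> 'a" and V :: "'i set"
  assumes measurable_X: "v \<in> V \<Longrightarrow> X v \<in> measurable P (N v)"
begin

abbreviation alg :: "'i set \<Rightarrow> 'w measure" where
  "alg \<equiv> rvec_algebra P N X"

lemma space_alg [simp]: "space (alg A) = space P"
  by (simp add: rvec_algebra_def)

text \<open>Together with \<open>measurable_X_alg\<close> this is the universal property of
  \<open>alg A\<close>, the smallest sigma-algebra making its variables measurable. The later
  inclusions follow from these two facts without returning to the product space.\<close>

lemma sets_alg_subset:
  assumes "space Q = space P" and "\<And>i. i \<in> A \<Longrightarrow> X i \<in> measurable Q (N i)"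
  shows "sets (alg A) \<subseteq> sets Q"
  unfolding rvec_algebra_def rvec_def[abs_def]
  using assms by (intro sets_image_in_sets measurable_restrict) auto

lemma measurable_X_alg:
  assumes "A \<subseteq> V" "i \<in> A"
  shows "X i \<in> measurable (alg A) (N i)"
proof -
  have "rvec X A \<in> measurable P (PiM A N)"
    unfolding rvec_def[abs_def] using assms measurable_X by (intro measurable_restrict) auto
  then have "rvec X A \<in> measurable (alg A) (PiM A N)"
    unfolding rvec_algebra_def
    by (intro measurable_vimage_algebra1) (auto dest: measurable_space)
  then have "(\<lambda>\<omega>. rvec X A \<omega> i) \<in> measurable (alg A) (N i)"
    using assms(2) by (rule measurable_compose[OF _ measurable_component_singleton])
  then show ?thesis
    using assms(2) by (simp add: rvec_def)
qed

lemma subalgebra_alg: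
  assumes "A \<subseteq> V"
  shows "subalgebra P (alg A)"
  using sets_alg_subset[of P A] assms measurable_X by (auto simp: subalgebra_def)

lemma subalgebra_alg_mono:
  assumes "A \<subseteq> B" "B \<subseteq> V"
  shows "subalgebra (alg B) (alg A)"
  using sets_alg_subset[of "alg B" A] assms measurable_X_alg by (auto simp: subalgebra_def)

text \<open>Intersecting with the whole space puts \<open>alg B\<close> and \<open>alg C\<close>
  inside the generator \<open>?G\<close>. So every variable of \<open>B \<union> C\<close> is
  measurable for \<open>sigma (space P) ?G\<close>, and minimality of
  \<open>alg (B \<union> C)\<close> applies.\<close>

lemma sets_alg_Un:
  assumes "B \<union> C \<subseteq> V"
  shows "sets (alg (B \<union> C)) \<subseteq>
    sigma_sets (space P) {F \<inter> G | F G. F \<in> sets (alg B) \<and> G \<in> sets (alg C)}" (is "_ \<subseteq> sigma_sets _ ?G")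
proof -
  have Pow: "?G \<subseteq> Pow (space P)"
    using sets.sets_into_space[of _ "alg B"] by auto
  have top: "space P \<in> sets (alg A)" for A
    using sets.top[of "alg A"] by simp
  have into_space: "F \<inter> space P = F" "space P \<inter> F = F" if "F \<in> sets (alg A)" for F A
    using sets.sets_into_space[OF that] by auto
  have B: "sets (alg B) \<subseteq> ?G"
  proof
    fix F assume "F \<in> sets (alg B)"
    then have "F \<inter> space P \<in> ?G" using top by blast
    then show "F \<in> ?G" using into_space(1)[OF \<open>F \<in> _\<close>] by simp
  qed
  have C: "sets (alg C) \<subseteq> ?G"
  proof
    fix F assume "F \<in> sets (alg C)"
    then have "space P \<inter> F \<in> ?G" using top by blast
    then show "F \<in> ?G" using into_space(2)[OF \<open>F \<in> _\<close>] by simp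
  qed
  have meas: "X i \<in> measurable (sigma (space P) ?G) (N i)"
    if "i \<in> A" "A \<subseteq> V" "sets (alg A) \<subseteq> ?G" for i A
  proof -
    have "?G \<subseteq> sets (sigma (space P) ?G)"
      using Pow by (simp add: sigma_sets_superset_generator)
    then have "measurable (alg A) (N i) \<subseteq> measurable (sigma (space P) ?G) (N i)"
      using that(3) Pow by (intro measurable_mono) simp_all
    then show ?thesis using measurable_X_alg[OF that(2,1)] by (rule subsetD)
  qed
  have "X i \<in> measurable (sigma (space P) ?G) (N i)" if "i \<in> B \<union> C" for i
    using that assms meas[of i B, OF _ _ B] meas[of i C, OF _ _ C] by auto
  then have "sets (alg (B \<union> C)) \<subseteq> sets (sigma (space P) ?G)"
    using Pow by (intro sets_alg_subset) simp_all
  then show ?thesis using Pow by simp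
qed

section \<open>Equivalence of sets of variables for a fixed target\<close>

text \<open>The exceptional null set may depend on the event \<open>E\<close>, so no regular
  conditional distribution has to exist.\<close>

definition equally_informative :: "'i set \<Rightarrow> 'i set \<Rightarrow> 'i set \<Rightarrow> bool" where
  "equally_informative A T T' \<longleftrightarrow> (\<forall>E\<in>sets (alg A). AE \<omega> in P.
     real_cond_exp P (alg T) (indicator E) \<omega> = real_cond_exp P (alg T') (indicator E) \<omega>)"

lemma cond_indep_iff_equally_informative:
  assumes "A \<subseteq> V" "B \<subseteq> V" "C \<subseteq> V"
  shows "cond_indep P N X A B C \<longleftrightarrow> equally_informative A (B \<union> C) C"
  unfolding cond_indep_def equally_informative_def
proof (intro ball_cong refl cond_exp_factorizes_iff_cond_exp_eq)
  show "subalgebra P (alg C)" "subalgebra P (alg (B \<union> C))" "subalgebra P (alg B)"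
    using assms by (auto intro: subalgebra_alg)
  show "subalgebra (alg (B \<union> C)) (alg C)" "sets (alg B) \<subseteq> sets (alg (B \<union> C))"
    using assms subalgebra_alg_mono[of _ "B \<union> C"] by (auto simp: subalgebra_def)
  show "sets (alg (B \<union> C)) \<subseteq>
      sigma_sets (space P) {F \<inter> G | F G. F \<in> sets (alg B) \<and> G \<in> sets (alg C)}"
    using assms by (intro sets_alg_Un) auto
  show "E \<in> sets P" if "E \<in> sets (alg A)" for E
    using that subalgebra_alg[OF assms(1)] by (auto simp: subalgebra_def)
qed

lemma cond_indep_commute: "cond_indep P N X A B C \<longleftrightarrow> cond_indep P N X B A C"
  unfolding cond_indep_def by (subst Int_commute, subst mult.commute) blast

lemma equally_informative_refl: "equally_informative A T T"
  by (simp add: equally_informative_def)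

lemma equally_informative_sym: "equally_informative A T T' \<Longrightarrow> equally_informative A T' T"
  by (simp add: equally_informative_def eq_commute)

lemma equally_informative_trans:
  "equally_informative A T T' \<Longrightarrow> equally_informative A T' T'' \<Longrightarrow> equally_informative A T T''"
  unfolding equally_informative_def by (fastforce elim: eventually_elim2)

text \<open>Condition both sides of the equality on \<open>T'\<close>: the left side collapses by
  the tower property, and the right side is already \<open>T'\<close>-measurable. In graphoid terms
  this is decomposition; with symmetry and transitivity it also yields weak union, and transitivity
  itself gives contraction.\<close>

lemma equally_informative_intermediate:
  assumes V: "A \<subseteq> V" "T \<subseteq> V" and sub: "T'' \<subseteq> T'" "T' \<subseteq> T"
    and eq: "equally_informative A T T''"
  shows "equally_informative A T' T''"
  unfolding equally_informative_def
proof
  fix E assume E: "E \<in> sets (alg A)"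
  interpret T': sigma_finite_subalgebra P "alg T'"
    using V sub by (intro sigma_finite_subalgebraI subalgebra_alg) auto
  interpret T'': sigma_finite_subalgebra P "alg T''"
    using V sub by (intro sigma_finite_subalgebraI subalgebra_alg) auto
  have "E \<in> sets P"
    using E subalgebra_alg[OF V(1)] by (auto simp: subalgebra_def)
  then have int: "integrable P (indicator E :: 'w \<Rightarrow> real)"
    by (simp add: emeasure_eq_measure)
  have "AE \<omega> in P. real_cond_exp P (alg T) (indicator E) \<omega> = real_cond_exp P (alg T'') (indicator E) \<omega>"
    using eq E by (simp add: equally_informative_def)
  then have "AE \<omega> in P. real_cond_exp P (alg T') (real_cond_exp P (alg T) (indicator E)) \<omega> =
      real_cond_exp P (alg T') (real_cond_exp P (alg T'') (indicator E)) \<omega>"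
    by (rule T'.real_cond_exp_cong) measurable
  moreover have "AE \<omega> in P. real_cond_exp P (alg T') (real_cond_exp P (alg T) (indicator E)) \<omega> =
      real_cond_exp P (alg T') (indicator E) \<omega>"
    using V sub int by (intro T'.real_cond_exp_nested_subalg subalgebra_alg subalgebra_alg_mono)
  moreover have "AE \<omega> in P. real_cond_exp P (alg T') (real_cond_exp P (alg T'') (indicator E)) \<omega> =
      real_cond_exp P (alg T'') (indicator E) \<omega>"
    using V sub int
    by (intro T'.real_cond_exp_F_meas T''.real_cond_exp_int
        measurable_from_subalg[OF subalgebra_alg_mono[of T'' T']]) auto
  ultimately show "AE \<omega> in P. real_cond_exp P (alg T') (indicator E) \<omega> =
      real_cond_exp P (alg T'') (indicator E) \<omega>"
    by eventually_elim simp
qed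


section \<open>Markov blankets and boundaries\<close>

lemma markov_blanket_iff:
  assumes "y \<in> V" "T \<subseteq> V"
  shows "markov_blanket P N X y T B \<longleftrightarrow> B \<subseteq> T \<and> equally_informative {y} T B"
proof (cases "B \<subseteq> T")
  case True
  then have "cond_indep P N X {y} (T - B) B \<longleftrightarrow> equally_informative {y} ((T - B) \<union> B) B"
    using assms by (intro cond_indep_iff_equally_informative) auto
  moreover have "(T - B) \<union> B = T" using True by blast
  ultimately show ?thesis by (simp add: markov_blanket_def)
qed (simp add: markov_blanket_def)

text \<open>Translates the removal test of Algorithm 1 into the equivalence with target
  \<open>y\<close>.\<close>

lemma cond_indep_single_iff:
  assumes "y \<in> V" "B \<subseteq> V" "x \<in> B"
  shows "cond_indep P N X {x} {y} (B - {x}) \<longleftrightarrow> equally_informative {y} B (B - {x})"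
proof -
  have "{x} \<union> (B - {x}) = B" using assms(3) by blast
  then show ?thesis
    using assms cond_indep_iff_equally_informative[of "{y}" "{x}" "B - {x}"]
    by (auto simp: cond_indep_commute[of "{x}"])
qed

text \<open>Contraction along the chain \<open>S\<close>, \<open>B\<close>, \<open>B - {x}\<close>;
  it preserves the invariant of Algorithm 1.\<close>

lemma markov_blanket_remove:
  assumes V: "y \<in> V" "S \<subseteq> V" and B: "markov_blanket P N X y S B" and x: "x \<in> B"
    and indep: "cond_indep P N X {x} {y} (B - {x})"
  shows "markov_blanket P N X y S (B - {x})"
proof -
  have "B \<subseteq> S" "equally_informative {y} S B"
    using B by (auto simp: markov_blanket_iff[OF V])
  moreover have "equally_informative {y} B (B - {x})"
    using indep V x \<open>B \<subseteq> S\<close> by (subst cond_indep_single_iff[symmetric]) auto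
  ultimately show ?thesis
    using equally_informative_trans by (auto simp: markov_blanket_iff[OF V])
qed

text \<open>Single deletions suffice to exclude all proper subsets: equivalence with
  \<open>S\<close> passes from a blanket \<open>B'\<close> up to every set between \<open>B'\<close>
  and \<open>S\<close>, in particular to \<open>B - {x}\<close> for an \<open>x\<close> omitted by
  \<open>B'\<close>.\<close>

lemma markov_boundaryI:
  assumes V: "y \<in> V" "S \<subseteq> V" and B: "markov_blanket P N X y S B"
    and dep: "\<And>x. x \<in> B \<Longrightarrow> \<not> cond_indep P N X {x} {y} (B - {x})"
  shows "markov_boundary P N X y S B"
  unfolding markov_boundary_def
proof (intro conjI allI impI notI B)
  fix B' assume sub: "B' \<subset> B" and "markov_blanket P N X y S B'"
  then have B': "equally_informative {y} S B'"
    by (simp add: markov_blanket_iff[OF V])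
  have BS: "B \<subseteq> S" and eqB: "equally_informative {y} S B"
    using B by (auto simp: markov_blanket_iff[OF V])
  from sub obtain x where "x \<in> B" "x \<notin> B'" by auto
  with sub have x: "x \<in> B" "B' \<subseteq> B - {x}" by auto
  have "equally_informative {y} (B - {x}) B'"
    using V x BS by (intro equally_informative_intermediate[OF _ _ _ _ B']) auto
  then have "equally_informative {y} B (B - {x})"
    using eqB B' equally_informative_sym equally_informative_trans by blast
  then show False
    using dep[OF x(1)] V BS x by (subst (asm) cond_indep_single_iff) auto
qed

text \<open>Used contrapositively: minimality within \<open>T\<close> excludes smaller blankets
  within \<open>S\<close> as well.\<close>

lemma markov_blanket_of_subset:
  assumes V: "y \<in> V" "S \<subseteq> V" and B: "markov_blanket P N X y S B" and sub: "B \<subseteq> T" "T \<subseteq> S"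
  shows "markov_blanket P N X y T B"
proof -
  have "equally_informative {y} S B"
    using B by (simp add: markov_blanket_iff[OF V])
  then have "equally_informative {y} T B"
    by (rule equally_informative_intermediate[rotated 4]) (use V sub in auto)
  then show ?thesis
    using V sub by (subst markov_blanket_iff) auto
qed

text \<open>The link is \<open>B \<union> B'\<close>: it lies between \<open>B\<close> and
  \<open>S\<close>, hence is equivalent to \<open>B\<close>, and the independence makes it
  equivalent to \<open>B'\<close>.\<close>

lemma markov_blanket_transfer:
  assumes V: "y \<in> V" "S \<subseteq> V" and B: "markov_blanket P N X y S B" and B': "B' \<subseteq> S"
    and indep: "cond_indep P N X {y} B B'"
  shows "markov_blanket P N X y S B'"
proof -
  have BS: "B \<subseteq> S" and eqB: "equally_informative {y} S B"
    using B by (auto simp: markov_blanket_iff[OF V])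
  have "equally_informative {y} (B \<union> B') B"
    using V BS B' by (intro equally_informative_intermediate[OF _ _ _ _ eqB]) auto
  moreover have "equally_informative {y} (B \<union> B') B'"
    using indep V BS B' by (subst (asm) cond_indep_iff_equally_informative) auto
  ultimately have "equally_informative {y} S B'"
    using eqB equally_informative_sym equally_informative_trans by blast
  then show ?thesis
    using B' by (simp add: markov_blanket_iff[OF V])
qed

text \<open>\<open>A \<union> B\<close> lies between \<open>B\<close> and \<open>S\<close>.
  Contrapositively, a failed test of Algorithm 2 shows that the tested set is not a blanket within
  \<open>S\<close>.\<close>

lemma cond_indep_of_markov_blanket:
  assumes V: "y \<in> V" "S \<subseteq> V" and B: "markov_blanket P N X y S B" and A: "A \<subseteq> S"
  shows "cond_indep P N X {y} A B"
proof -
  have "B \<subseteq> S" and eq: "equally_informative {y} S B"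
    using B by (auto simp: markov_blanket_iff[OF V])
  then have "equally_informative {y} (A \<union> B) B"
    using V A by (intro equally_informative_intermediate[OF _ _ _ _ eq]) auto
  then show ?thesis
    using V A \<open>B \<subseteq> S\<close> by (subst cond_indep_iff_equally_informative) auto
qed

text \<open>Justifies the verdict of multiple boundaries: a boundary within a smaller set that
  passes the test is also one within \<open>S\<close>.\<close>

lemma markov_boundary_transfer:
  assumes V: "y \<in> V" "S \<subseteq> V" and B: "markov_blanket P N X y S B" and T: "T \<subseteq> S"
    and B': "markov_boundary P N X y T B'" and indep: "cond_indep P N X {y} B B'"
  shows "markov_boundary P N X y S B'"
proof -
  have B'T: "B' \<subseteq> T"
    using B' by (simp add: markov_boundary_def markov_blanket_def)
  have "markov_blanket P N X y S B'"
    using B'T T by (intro markov_blanket_transfer[OF V B _ indep]) auto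
  moreover have "\<not> markov_blanket P N X y S B''" if "B'' \<subset> B'" for B''
    using markov_blanket_of_subset[OF V _ _ T] B' B'T that unfolding markov_boundary_def by blast
  ultimately show ?thesis by (simp add: markov_boundary_def)
qed

text \<open>Justifies the verdict of uniqueness. The assumption \<open>wit\<close> records one
  failed test for each element of \<open>B\<close>; one boundary per element is enough, since a
  competitor \<open>C\<close> avoiding \<open>x\<close> would make any blanket within
  \<open>S - {x}\<close> a blanket within \<open>S\<close>.\<close>

lemma markov_boundary_unique:
  assumes V: "y \<in> V" "S \<subseteq> V" and B: "markov_boundary P N X y S B"
    and wit: "\<And>x. x \<in> B \<Longrightarrow>
      \<exists>B'. markov_boundary P N X y (S - {x}) B' \<and> \<not> cond_indep P N X {y} B B'"
    and C: "markov_boundary P N X y S C"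
  shows "C = B"
proof (rule ccontr)
  assume "C \<noteq> B"
  \<comment> \<open>A proper superset of \<open>B\<close> would contradict the minimality of
    \<open>C\<close>, so \<open>C\<close> must miss an element of \<open>B\<close>.\<close>
  moreover have "\<not> B \<subset> C"
    using B C by (auto simp: markov_boundary_def)
  ultimately obtain x where x: "x \<in> B" "x \<notin> C" by auto
  with wit obtain B' where B': "markov_blanket P N X y (S - {x}) B'"
    and dep: "\<not> cond_indep P N X {y} B B'"
    unfolding markov_boundary_def by blast
  have CS: "C \<subseteq> S - {x}" and Cb: "markov_blanket P N X y S C"
    using C x by (auto simp: markov_boundary_def markov_blanket_def)
  have "cond_indep P N X {y} C B'"
    using V CS by (intro cond_indep_of_markov_blanket[OF _ _ B']) auto
  moreover have "B' \<subseteq> S"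
    using B' by (auto simp: markov_blanket_def)
  ultimately have "markov_blanket P N X y S B'"
    by (intro markov_blanket_transfer[OF V Cb])
  moreover have "B \<subseteq> S"
    using B by (simp add: markov_boundary_def markov_blanket_def)
  ultimately show False
    using cond_indep_of_markov_blanket[OF V] dep by blast
qed

end

section \<open>Invariants and termination of transition relations\<close>

lemma always_terminatesI:
  fixes m :: "'s \<Rightarrow> nat"
  assumes init: "I init"
    and step: "\<And>s s'. step s s' \<Longrightarrow> I s \<Longrightarrow> I s' \<and> m s' < m s"
    and progress: "\<And>s. I s \<Longrightarrow> s \<notin> final \<Longrightarrow> \<exists>s'. step s s'"
  shows "always_terminates step init final" and "step\<^sup>*\<^sup>* init s \<Longrightarrow> I s"
proof -
  show reach: "I s" if "step\<^sup>*\<^sup>* init s" for s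
    using that by induction (use init step in blast)+
  have False if r: "r 0 = init" "\<And>n. step (r n) (r (Suc n))" for r
  proof -
    have I: "I (r n)" for n
    proof (induction n)
      case 0
      show ?case using init r(1) by simp
    next
      case (Suc n)
      then show ?case using step[OF r(2)] by simp
    qed
    \<comment> \<open>Each step lowers \<open>m\<close> by at least one, so a run cannot have more
      than \<open>m init\<close> steps.\<close>
    have "m (r n) + n \<le> m init" for n
    proof (induction n)
      case 0
      show ?case using r(1) by simp
    next
      case (Suc n)
      moreover have "m (r (Suc n)) < m (r n)" using step[OF r(2) I] by simp
      ultimately show ?case by simp
    qed
    from this[of "Suc (m init)"] show False by simp
  qed
  then show "always_terminates step init final"
    unfolding always_terminates_def using reach progress by blast
qed

section \<open>Correctness of the two algorithms\<close>

context random_family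
begin

lemma algorithm1:
  assumes V: "V = insert y S" and y: "y \<notin> S" and fin: "finite S"
    and \<Delta>: "association_measure P N X V \<Delta>"
  shows "always_terminates (alg1_step P N X \<Delta> y) (Loop1 S) (range Output1)"
    and "(alg1_step P N X \<Delta> y)\<^sup>*\<^sup>* (Loop1 S) (Output1 B) \<Longrightarrow> markov_boundary P N X y S B"
proof -
  have yV: "y \<in> V" and SV: "S \<subseteq> V" using V by auto
  define I where "I s = (case s of Loop1 B \<Rightarrow> markov_blanket P N X y S B
    | Output1 B \<Rightarrow> markov_boundary P N X y S B)" for s
  \<comment> \<open>The \<open>Suc\<close> makes the step to the output decrease the measure even
    from the empty set.\<close>
  define m :: "'i alg1_state \<Rightarrow> nat" where
    "m s = (case s of Loop1 B \<Rightarrow> Suc (card B) | Output1 B \<Rightarrow> 0)" for s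
  have blanket_sub: "B \<subseteq> S" if "markov_blanket P N X y S B" for B
    using that by (simp add: markov_blanket_def)
  have init: "I (Loop1 S)"
    by (simp add: I_def markov_blanket_iff[OF yV SV] equally_informative_refl)
  have step: "I s' \<and> m s' < m s" if "alg1_step P N X \<Delta> y s s'" "I s" for s s'
    using that
  proof cases
    case alg1_empty
    then show ?thesis
      using \<open>I s\<close> by (auto simp: I_def m_def intro: markov_boundaryI[OF yV SV])
  next
    case (alg1_remove B x0)
    have "x0 \<in> B" "markov_blanket P N X y S B"
      using alg1_remove \<open>I s\<close> by (auto simp: I_def is_arg_min_def)
    moreover from this have "card (B - {x0}) < card B"
      using blanket_sub fin finite_subset by (intro card_Diff1_less) blast+
    ultimately show ?thesis
      using alg1_remove markov_blanket_remove[OF yV SV] by (simp add: I_def m_def)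
  next
    case (alg1_stop B x0)
    have B: "markov_blanket P N X y S B" and x0: "x0 \<in> B"
      using alg1_stop \<open>I s\<close> by (auto simp: I_def is_arg_min_def)
    \<comment> \<open>The minimizer \<open>x0\<close> has the weakest association and is still
      dependent on \<open>y\<close>, so the monotonicity of \<open>\<Delta>\<close> carries
      dependence to every other element.\<close>
    have "\<not> cond_indep P N X {x} {y} (B - {x})" if x: "x \<in> B" for x
    proof -
      have "\<Delta> x0 y (B - {x0}) \<le> \<Delta> x y (B - {x})"
        using alg1_stop(3) x by (auto simp: is_arg_min_def not_less)
      moreover have V_mem: "z \<in> V" "z \<noteq> y" "B - {z} \<subseteq> V - {z, y}" if "z \<in> B" for z
        using that y V blanket_sub[OF B] by auto
      ultimately show ?thesis
        using \<Delta>[unfolded association_measure_def, rule_format, of x0 y "B - {x0}" x y "B - {x}"]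
          alg1_stop(4) yV V_mem[OF x0] V_mem[OF x] by simp
    qed
    then show ?thesis
      using alg1_stop B by (auto simp: I_def m_def intro: markov_boundaryI[OF yV SV])
  qed
  have progress: "\<exists>s'. alg1_step P N X \<Delta> y s s'" if "I s" "s \<notin> range Output1" for s
  proof -
    from that obtain B where s: "s = Loop1 B" and "B \<subseteq> S"
      using blanket_sub by (cases s) (auto simp: I_def)
    show ?thesis
    proof (cases "B = {}")
      case True
      then show ?thesis using s by (auto intro: alg1_empty)
    next
      case False
      then have "\<exists>x0. is_arg_min (\<lambda>x. \<Delta> x y (B - {x})) (\<lambda>x. x \<in> B) x0"
        by (intro ex_is_arg_min_if_finite finite_subset[OF \<open>B \<subseteq> S\<close> fin])
      then obtain x0 where "is_arg_min (\<lambda>x. \<Delta> x y (B - {x})) (\<lambda>x. x \<in> B) x0" ..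
      then show ?thesis
        unfolding s by (cases "cond_indep P N X {x0} {y} (B - {x0})") (auto intro: alg1_remove alg1_stop)
    qed
  qed
  show "always_terminates (alg1_step P N X \<Delta> y) (Loop1 S) (range Output1)"
    using init step progress by (rule always_terminatesI)
  show "markov_boundary P N X y S B"
    if "(alg1_step P N X \<Delta> y)\<^sup>*\<^sup>* (Loop1 S) (Output1 B)"
  proof -
    have "I (Output1 B)"
      using init step progress that by (rule always_terminatesI(2))
    then show ?thesis by (simp add: I_def)
  qed
qed

lemma algorithm2:
  assumes yV: "y \<in> V" and SV: "S \<subseteq> V" and fin: "finite S"
    and \<Omega>: "correct_boundary_algorithm P N X y S \<Omega>"
  shows "always_terminates (alg2_step P N X \<Omega> y S) Start2 (range Output2)"
    and "(alg2_step P N X \<Omega> y S)\<^sup>*\<^sup>* Start2 (Output2 Unique_Boundary) \<Longrightarrow>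
      \<exists>!B. markov_boundary P N X y S B"
    and "(alg2_step P N X \<Omega> y S)\<^sup>*\<^sup>* Start2 (Output2 Multiple_Boundaries) \<Longrightarrow>
      \<exists>B B'. B \<noteq> B' \<and> markov_boundary P N X y S B \<and> markov_boundary P N X y S B'"
proof -
  let ?mb = "markov_boundary P N X y"
  \<comment> \<open>In the loop, \<open>B - set xs\<close> consists of the elements already
    examined; for each, the boundary that failed the test is remembered.\<close>
  define I where "I s = (case s of Start2 \<Rightarrow> True
    | Loop2 B xs \<Rightarrow> ?mb S B \<and> set xs \<subseteq> B \<and>
        (\<forall>x\<in>B - set xs. \<exists>B'. ?mb (S - {x}) B' \<and> \<not> cond_indep P N X {y} B B')
    | Output2 Unique_Boundary \<Rightarrow> (\<exists>!B. ?mb S B)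
    | Output2 Multiple_Boundaries \<Rightarrow> (\<exists>B B'. B \<noteq> B' \<and> ?mb S B \<and> ?mb S B'))" for s
  \<comment> \<open>The first list is a distinct enumeration of a subset of \<open>S\<close>, so the
    first loop state has measure at most \<open>Suc (card S)\<close>.\<close>
  define m :: "'i alg2_state \<Rightarrow> nat" where
    "m s = (case s of Start2 \<Rightarrow> Suc (Suc (card S)) | Loop2 B xs \<Rightarrow> Suc (length xs)
      | Output2 v \<Rightarrow> 0)" for s
  have out: "?mb T B" if "\<Omega> T B" "T \<subseteq> S" for T B
    using \<Omega> that by (simp add: correct_boundary_algorithm_def)
  have ex: "\<exists>B. \<Omega> T B" if "T \<subseteq> S" for T
    using \<Omega> that by (simp add: correct_boundary_algorithm_def)
  have sub: "B \<subseteq> T" if "?mb T B" for T B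
    using that by (simp add: markov_boundary_def markov_blanket_def)
  have init: "I Start2" by (simp add: I_def)
  have step: "I s' \<and> m s' < m s" if "alg2_step P N X \<Omega> y S s s'" "I s" for s s'
    using that
  proof cases
    case (alg2_start B xs)
    have B: "?mb S B" using out alg2_start by blast
    have "length xs \<le> card S"
      using alg2_start sub[OF B] fin card_mono distinct_card by metis
    then show ?thesis using B alg2_start by (simp add: I_def m_def)
  next
    case (alg2_multiple x B' B xs)
    have B: "?mb S B" and x: "x \<in> B" using alg2_multiple \<open>I s\<close> by (auto simp: I_def)
    have B': "?mb (S - {x}) B'" using out alg2_multiple by blast
    have "?mb S B'"
      using B alg2_multiple by (intro markov_boundary_transfer[OF yV SV _ _ B'])
        (auto simp: markov_boundary_def)
    \<comment> \<open>The examined \<open>x\<close> lies in \<open>B\<close>, while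
      \<open>B'\<close> was computed with \<open>x\<close> withheld.\<close>
    moreover have "B \<noteq> B'" using x sub[OF B'] by blast
    ultimately show ?thesis using B alg2_multiple by (auto simp: I_def m_def)
  next
    case (alg2_next x B' B xs)
    have "?mb (S - {x}) B'" using out alg2_next by blast
    then show ?thesis using alg2_next \<open>I s\<close> by (auto simp: I_def m_def)
  next
    case (alg2_unique B)
    \<comment> \<open>With an empty list the invariant covers every element of
      \<open>B\<close>.\<close>
    then have "?mb S B"
      and "\<And>x. x \<in> B \<Longrightarrow> \<exists>B'. ?mb (S - {x}) B' \<and> \<not> cond_indep P N X {y} B B'"
      using \<open>I s\<close> by (auto simp: I_def)
    then have "\<exists>!B. ?mb S B"
      using markov_boundary_unique[OF yV SV] by blast
    then show ?thesis using alg2_unique by (simp add: I_def m_def)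
  qed
  have progress: "\<exists>s'. alg2_step P N X \<Omega> y S s s'" if "I s" "s \<notin> range Output2" for s
  proof (cases s)
    case Start2
    obtain B where B: "\<Omega> S B" using ex[of S] by blast
    have "finite B" using finite_subset[OF sub[OF out[OF B]] fin] by simp
    then obtain xs where "set xs = B" "distinct xs" using finite_distinct_list by blast
    then show ?thesis using Start2 B by (auto intro: alg2_start)
  next
    case (Loop2 B xs)
    show ?thesis
    proof (cases xs)
      case Nil
      then show ?thesis using Loop2 by (auto intro: alg2_unique)
    next
      case (Cons x xs')
      obtain B' where "\<Omega> (S - {x}) B'" using ex[of "S - {x}"] by blast
      then show ?thesis
        unfolding Loop2 Cons by (cases "cond_indep P N X {y} B B'") (auto intro: alg2_multiple alg2_next)
    qed
  next
    case (Output2 v)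
    then show ?thesis using that by blast
  qed
  show "always_terminates (alg2_step P N X \<Omega> y S) Start2 (range Output2)"
    using init step progress by (rule always_terminatesI)
  have reach: "I s" if "(alg2_step P N X \<Omega> y S)\<^sup>*\<^sup>* Start2 s" for s
    using init step progress that by (rule always_terminatesI(2))
  show "\<exists>!B. ?mb S B" if "(alg2_step P N X \<Omega> y S)\<^sup>*\<^sup>* Start2 (Output2 Unique_Boundary)"
    using reach[OF that] by (simp add: I_def)
  show "\<exists>B B'. B \<noteq> B' \<and> ?mb S B \<and> ?mb S B'"
    if "(alg2_step P N X \<Omega> y S)\<^sup>*\<^sup>* Start2 (Output2 Multiple_Boundaries)"
    using reach[OF that] by (simp add: I_def)
qed

end

theorem proposition5:
  fixes P :: "'w measure" and N :: "'i \<Rightarrow> 'a measure" and X :: "'i \<Rightarrow> 'w \<Rightarrow> 'a"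
    and S :: "'i set" and y :: 'i
  assumes "prob_space P"
    and "finite S"
    and "y \<notin> S"
    and "\<And>v. v \<in> insert y S \<Longrightarrow> X v \<in> measurable P (N v)"
  shows
    "(\<forall>\<Delta> :: 'i \<Rightarrow> 'i \<Rightarrow> 'i set \<Rightarrow> real.
        association_measure P N X (insert y S) \<Delta> \<longrightarrow>
        always_terminates (alg1_step P N X \<Delta> y) (Loop1 S) (range Output1) \<and>
        (\<forall>B. (alg1_step P N X \<Delta> y)\<^sup>*\<^sup>* (Loop1 S) (Output1 B) \<longrightarrow> markov_boundary P N X y S B)) \<and>
     (\<forall>\<Omega> :: 'i set \<Rightarrow> 'i set \<Rightarrow> bool.
        correct_boundary_algorithm P N X y S \<Omega> \<longrightarrow>
        always_terminates (alg2_step P N X \<Omega> y S) Start2 (range Output2) \<and>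
        ((alg2_step P N X \<Omega> y S)\<^sup>*\<^sup>* Start2 (Output2 Unique_Boundary) \<longrightarrow>
           (\<exists>!B. markov_boundary P N X y S B)) \<and>
        ((alg2_step P N X \<Omega> y S)\<^sup>*\<^sup>* Start2 (Output2 Multiple_Boundaries) \<longrightarrow>
           (\<exists>B B'. B \<noteq> B' \<and> markov_boundary P N X y S B \<and> markov_boundary P N X y S B')))"
proof -
  interpret random_family P N X "insert y S"
    using assms by (simp add: random_family_def random_family_axioms_def)
  note algorithm1 = algorithm1[OF refl \<open>y \<notin> S\<close> \<open>finite S\<close>]
    and algorithm2 = algorithm2[OF insertI1 subset_insertI \<open>finite S\<close>]
  show ?thesis
    by (intro conjI allI impI; (rule algorithm1 algorithm2; assumption))
qed

end
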